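(* The bivariate exponential generating function $\Phi(x,y;\Gamma)$ for the numbers $\phi(k,n;\Gamma)$ of $k\times n$ $(0,1)$-matrices avoiding $\Gamma=\begin{pmatrix}1&1\\1&0\end{pmatrix}$ is $$\Phi(x,y;\Gamma)=\exp\left[(e^x-1)(e^y-1)+x+y\right].$$
   Context: A $(0,1)$-matrix is a matrix with all entries in $\{0,1\}$. A $2\times2$ submatrix of a matrix is obtained by choosing two rows $i_1<i_2$ and two columns $j_1<j_2$. Let $\Gamma=\begin{pmatrix}1&1\\1&0\end{pmatrix}$ and let $[\Gamma]$ be its equivalence class under row exchanges and column exchanges, i.e. the four $2\times2$ $(0,1)$-matrices with exactly three entries equal to $1$. A $(0,1)$-matrix avoids $\Gamma$ if none of its $2\times2$ submatrices belongs to $[\Gamma]$. $\phi(k,n;\Gamma)$ is the number of $k\times n$ $(0,1)$-matrices avoiding $\Gamma$. By convention, the set of $0\times 0$ matrices is $\{\emptyset\}$ and the sets of $k\times 0$ and of $0\times n$ matrices are empty for positive integers $k$ and $n$, so that $\phi(0,0;\Gamma)=1$ and $\phi(k,0;\Gamma)=\phi(0,n;\Gamma)=0$ for positive integers $k$ and $n$. The generating function is defined by $$\Phi(x,y;\Gamma):=\sum_{n\ge 0}\sum_{k\ge 0}\phi(k,n;\Gamma)\,\frac{x^k}{k!}\frac{y^n}{n!}=1+\sum_{n\ge 1}\sum_{k\ge 1}\phi(k,n;\Gamma)\,\frac{x^k}{k!}\frac{y^n}{n!}.$$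
   Formalization: With φ(k,0)=φ(0,n)=0 the identity fails at y=0 (1 versus e^x); proved instead: the identity with one k×0 and one 0×n matrix counted, and, under the stated convention, Φ = exp[(e^x−1)(e^y−1)+x+y] − (e^x−1) − (e^y−1). *)

theory Defs
  imports
    "HOL-Computational_Algebra.Formal_Power_Series"
    "Jordan_Normal_Form.Gauss_Jordan_Elimination"
    "Jordan_Normal_Form.Column_Operations"
    "Jordan_Normal_Form.DL_Submatrix"
begin

section \<open>Matrices avoiding a pattern\<close>

inductive_set exchange_class :: "'a mat \<Rightarrow> 'a mat set" for P :: "'a mat" where
  base: "P \<in> exchange_class P"
| rows: "M \<in> exchange_class P \<Longrightarrow> i < dim_row M \<Longrightarrow> j < dim_row M
    \<Longrightarrow> swaprows i j M \<in> exchange_class P"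
| cols: "M \<in> exchange_class P \<Longrightarrow> i < dim_col M \<Longrightarrow> j < dim_col M
    \<Longrightarrow> swapcols i j M \<in> exchange_class P"

definition zero_one_mats :: "nat \<Rightarrow> nat \<Rightarrow> nat mat set" where
  "zero_one_mats k n = {A \<in> carrier_mat k n. elements_mat A \<subseteq> {0, 1}}"

definition avoids :: "nat mat \<Rightarrow> nat mat \<Rightarrow> bool" where
  "avoids A P \<longleftrightarrow>
    (\<forall>i1 i2 j1 j2. i1 < i2 \<and> i2 < dim_row A \<and> j1 < j2 \<and> j2 < dim_col A \<longrightarrow>
      submatrix A {i1, i2} {j1, j2} \<notin> exchange_class P)"

definition Gamma_mat :: "nat mat" where
  "Gamma_mat = mat_of_rows_list 2 [[1, 1], [1, 0]]"

lemma exchange_class_Gamma_mat: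
  "exchange_class Gamma_mat =
    {mat_of_rows_list 2 [[1, 1], [1, 0]], mat_of_rows_list 2 [[1, 1], [0, 1]],
     mat_of_rows_list 2 [[1, 0], [1, 1]], mat_of_rows_list 2 [[0, 1], [1, 1]]}"
  (is "_ = {?a, ?b, ?c, ?d}")
proof -
  have b: "swapcols 0 1 ?a = ?b" and c: "swaprows 0 1 ?a = ?c" and d: "swapcols 0 1 ?c = ?d"
    by (rule eq_matI; auto simp: mat_of_rows_list_def less_Suc_eq)+
  have a: "?a \<in> exchange_class Gamma_mat"
    using exchange_class.base[of Gamma_mat] by (simp add: Gamma_mat_def)
  have b': "?b \<in> exchange_class Gamma_mat"
    using exchange_class.cols[OF a, of 0 1] unfolding b by (simp add: mat_of_rows_list_def)
  have c': "?c \<in> exchange_class Gamma_mat"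
    using exchange_class.rows[OF a, of 0 1] unfolding c by (simp add: mat_of_rows_list_def)
  have d': "?d \<in> exchange_class Gamma_mat"
    using exchange_class.cols[OF c', of 0 1] unfolding d by (simp add: mat_of_rows_list_def)
  have eq_iff: "M = mat_of_rows_list 2 [[p, q], [r, s]] \<longleftrightarrow> M \<in> carrier_mat 2 2 \<and>
      M $$ (0, 0) = p \<and> M $$ (0, Suc 0) = q \<and> M $$ (Suc 0, 0) = r \<and> M $$ (Suc 0, Suc 0) = s"
    for M :: "nat mat" and p q r s
    by (auto simp: mat_of_rows_list_def less_Suc_eq less_2_cases_iff intro!: eq_matI)
  have "M \<in> {?a, ?b, ?c, ?d}" if "M \<in> exchange_class Gamma_mat" for M
    using that
  proof induction
    case base
    then show ?case by (simp add: Gamma_mat_def)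
  next
    case (rows M i j)
    then have "M \<in> carrier_mat 2 2" unfolding eq_iff insert_iff by blast
    with rows show ?case unfolding eq_iff insert_iff by (auto simp: less_2_cases_iff)
  next
    case (cols M i j)
    then have "M \<in> carrier_mat 2 2" unfolding eq_iff insert_iff by blast
    with cols show ?case unfolding eq_iff insert_iff by (auto simp: less_2_cases_iff)
  qed
  with a b' c' d' show ?thesis by blast
qed

text \<open>
  Two conventions for matrices with an empty side. In \<open>phi\<close> there is exactly one
  \<open>k \<times> 0\<close> and one \<open>0 \<times> n\<close> matrix, as in the matrix library. In \<open>phi_pos\<close> there is a
  \<open>0 \<times> 0\<close> matrix, but no \<open>k \<times> 0\<close> or \<open>0 \<times> n\<close> matrix for positive \<open>k\<close>, \<open>n\<close>. They
  agree when \<open>k\<close>, \<open>n\<close> are both positive and when both are zero. The convention matters: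
  \<open>exp ((e^x - 1) (e^y - 1) + x + y)\<close> equals \<open>e^x\<close> at \<open>y = 0\<close> and \<open>e^y\<close> at \<open>x = 0\<close>,
  so it is the generating function of \<open>phi\<close>; that of \<open>phi_pos\<close> is 1 on both axes.
\<close>

definition phi :: "nat \<Rightarrow> nat \<Rightarrow> nat mat \<Rightarrow> nat" where
  "phi k n P = card {A \<in> zero_one_mats k n. avoids A P}"

definition phi_pos :: "nat \<Rightarrow> nat \<Rightarrow> nat mat \<Rightarrow> nat" where
  "phi_pos k n P =
    (if k = 0 \<and> n = 0 then 1 else if k = 0 \<or> n = 0 then 0
     else card {A \<in> zero_one_mats k n. avoids A P})"

section \<open>Bivariate formal power series\<close>

text \<open>
  A series in \<open>x\<close> and \<open>y\<close> is a series in \<open>y\<close> whose coefficients are series in \<open>x\<close>; the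
  coefficient of \<open>x^k y^n\<close> in \<open>F\<close> is \<open>F $ n $ k\<close>.
\<close>

unbundle fps_syntax
no_notation Matrix.vec_index (infixl \<open>$\<close> 100)

type_synonym bifps = "real fps fps"

definition X :: bifps where "X = fps_const fps_X"

definition Y :: bifps where "Y = fps_X"

definition biegf :: "(nat \<Rightarrow> nat \<Rightarrow> nat) \<Rightarrow> bifps" where
  "biegf f = Abs_fps (\<lambda>n. Abs_fps (\<lambda>k. real (f k n) / (fact k * fact n)))"

text \<open>
  The exponential \<open>\<Sum>m. F^m / m!\<close>, summed coefficient by coefficient. If \<open>F\<close> has no constant
  term, each of these sums has only finitely many nonzero terms. The topology of the type
  \<^typ>\<open>real fps fps\<close> is too fine for this: it does not make \<open>X^m\<close> tend to zero.
\<close>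

definition biexp :: "bifps \<Rightarrow> bifps" where
  "biexp F = Abs_fps (\<lambda>n. Abs_fps (\<lambda>k. \<Sum>m. (F ^ m) $ n $ k / fact m))"

lemma power_nth_nth_eq_0:
  fixes F :: bifps
  assumes "F $ 0 $ 0 = 0" "n + k < m"
  shows "(F ^ m) $ n $ k = 0"
  using assms(2)
proof (induction m arbitrary: n k)
  case (Suc m)
  have "F $ i $ j * (F ^ m) $ (n - i) $ (k - j) = 0" if "i \<le> n" "j \<le> k" for i j
  proof (cases "i = 0 \<and> j = 0")
    case False
    then have "(n - i) + (k - j) < m" using Suc.prems that by auto
    then show ?thesis using Suc.IH by simp
  qed (use assms(1) in simp)
  then show ?case by (auto simp: fps_mult_nth fps_sum_nth intro!: sum.neutral)
qed simp

lemma biexp_nth_nth: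
  assumes "F $ 0 $ 0 = 0"
  shows "biexp F $ n $ k = (\<Sum>m\<le>n + k. (F ^ m) $ n $ k / fact m)"
  unfolding biexp_def fps_nth_Abs_fps
  by (rule suminf_finite) (auto simp: power_nth_nth_eq_0[OF assms])

lemma biexp_X: "biexp X = fps_const (fps_exp 1)"
proof (intro fps_ext)
  fix n k
  have "(X ^ m) $ n $ k = (if n = 0 \<and> k = m then 1 else 0)" for m
    by (simp add: X_def fps_const_power fps_X_power_nth)
  then show "biexp X $ n $ k = fps_const (fps_exp 1) $ n $ k"
    by (subst biexp_nth_nth) (auto simp: X_def if_distribR if_distrib[of "\<lambda>c. c / _"] cong: if_cong)
qed

lemma biexp_Y: "biexp Y = Abs_fps (\<lambda>n. fps_const (1 / fact n))"
proof (intro fps_ext)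
  fix n k
  have "(Y ^ m) $ n $ k = (if k = 0 \<and> n = m then 1 else 0)" for m
    by (simp add: Y_def fps_X_power_nth)
  then show "biexp Y $ n $ k = Abs_fps (\<lambda>n. fps_const (1 / fact n)) $ n $ k"
    by (subst biexp_nth_nth) (auto simp: Y_def if_distrib[of "\<lambda>c. c / _"] cong: if_cong)
qed

end

theory Submission
  imports Defs
begin

text \<open>
  Read a matrix as the relation \<open>R\<close> between row and column indices given by its entries 1.
  Avoiding \<open>\<Gamma>\<close> means that whenever three corners of a rectangle lie in \<open>R\<close>, so does the fourth:
  \<open>R\<close> is difunctional (\<open>avoids_Gamma_iff\<close>). Equivalently, \<open>R\<close> is a disjoint union of blocks
  \<open>I \<times> J\<close> with \<open>I\<close>, \<open>J\<close> nonempty, where distinct blocks share no row and no column. The exponent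
  \<open>G = (e^x - 1) (e^y - 1) + x + y\<close> reflects this: its summands count a single block, a single
  zero row, and a single zero column.

  The proof turns this into a recursion and compares it with a differential equation. Single out
  one column \<open>c\<close>. Either it is zero, and the other columns form an arbitrary difunctional relation;
  or \<open>c\<close> lies in a block \<open>I \<times> insert c J\<close> with \<open>I\<close> nonempty and \<open>J\<close> arbitrary, and what
  remains is an arbitrary difunctional relation on the rows outside \<open>I\<close> and the columns outside
  \<open>insert c J\<close> (\<open>card_difunctional_insert\<close>). In terms of exponential generating functions,
  marking a column is \<open>\<partial>/\<partial>y\<close>, the zero column contributes 1, and the block contributes
  \<open>(e^x - 1) e^y\<close>. Since \<open>\<partial>G/\<partial>y = (e^x - 1) e^y + 1\<close>, the same recursion holds for the
  coefficients of \<open>exp G\<close> (\<open>biexp_block_series_Suc\<close>). Without columns both sides equal \<open>e^x\<close>, and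
  induction on the number of columns gives the first equation. The second one only subtracts the
  coefficients on the two axes.
\<close>

section \<open>Difunctional relations\<close>

definition difunctional :: "'a set \<Rightarrow> 'b set \<Rightarrow> ('a \<times> 'b) set set" where
  "difunctional K N = {R. R \<subseteq> K \<times> N \<and> R O R\<inverse> O R \<subseteq> R}"

lemma difunctional_iff:
  "R \<in> difunctional K N \<longleftrightarrow> R \<subseteq> K \<times> N \<and>
    (\<forall>i j i' j'. (i, j) \<in> R \<longrightarrow> (i, j') \<in> R \<longrightarrow> (i', j) \<in> R \<longrightarrow> (i', j') \<in> R)"
  unfolding difunctional_def by blast

lemma difunctional_subset: "R \<in> difunctional K N \<Longrightarrow> R \<subseteq> K \<times> N"
  by (simp add: difunctional_def)

lemma finite_difunctional: "finite K \<Longrightarrow> finite N \<Longrightarrow> finite (difunctional K N)"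
  by (rule finite_subset[of _ "Pow (K \<times> N)"]) (auto simp: difunctional_def)

lemma difunctional_empty: "difunctional K {} = {{}}" "difunctional {} N = {{}}"
  by (auto simp: difunctional_def)

text \<open>
  Together with the next lemma this describes the difunctional relations that have \<open>I \<times> J\<close> as
  a block: nothing else meets the rows in \<open>I\<close> or the columns in \<open>J\<close>, and what lies outside is
  free.
\<close>

lemma add_block_difunctional:
  assumes "I \<subseteq> K" "J \<subseteq> N" "R \<in> difunctional (K - I) (N - J)"
  shows "I \<times> J \<union> R \<in> difunctional K N"
  using assms unfolding difunctional_iff by blast

text \<open>
  The block of \<open>c\<close> has as rows the neighbours \<open>I\<close> of \<open>c\<close>, and as columns everything \<open>J\<close>
  adjacent to \<open>I\<close>. A pair of \<open>R\<close> has its row in \<open>I\<close> iff it has its column in \<open>J\<close>, so \<open>R\<close>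
  does not meet the two off-diagonal rectangles. If \<open>c\<close> has no neighbours, both \<open>I\<close> and \<open>J\<close>
  are empty.
\<close>

lemma split_block_difunctional:
  fixes R :: "('a \<times> 'b) set" and c :: 'b
  assumes R: "R \<in> difunctional K N"
  defines "I \<equiv> R\<inverse> `` {c}" and "J \<equiv> R `` (R\<inverse> `` {c})"
  shows "R = I \<times> J \<union> R \<inter> ((K - I) \<times> (N - J))"
    and "R \<inter> ((K - I) \<times> (N - J)) \<in> difunctional (K - I) (N - J)"
proof -
  have sub: "R \<subseteq> K \<times> N"
    and closed: "\<And>i j i' j'. (i, j) \<in> R \<Longrightarrow> (i, j') \<in> R \<Longrightarrow> (i', j) \<in> R \<Longrightarrow> (i', j') \<in> R"
    using R unfolding difunctional_iff by blast+
  have "i \<in> I \<longleftrightarrow> j \<in> J" if "(i, j) \<in> R" for i j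
    using that closed unfolding I_def J_def by blast
  moreover have "(i, j) \<in> R" if "i \<in> I" "j \<in> J" for i j
    using that closed unfolding I_def J_def by blast
  ultimately show "R = I \<times> J \<union> R \<inter> ((K - I) \<times> (N - J))"
    using sub by auto
  show "R \<inter> ((K - I) \<times> (N - J)) \<in> difunctional (K - I) (N - J)"
    unfolding difunctional_iff using closed by blast
qed

text \<open>
  The map \<open>h\<close> in the proof adjoins the block of \<open>c\<close> to a relation that avoids its rows and
  columns. It is injective because \<open>I\<close>, then \<open>J\<close>, then \<open>R\<close> can be read off from the result;
  its image consists of the relations in which \<open>c\<close> has a neighbour.
\<close>

lemma card_difunctional_insert:
  assumes fin: "finite K" "finite N" and c: "c \<notin> N"
  shows "card (difunctional K (insert c N)) = card (difunctional K N) +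
    (\<Sum>I\<in>Pow K - {{}}. \<Sum>J\<in>Pow N. card (difunctional (K - I) (N - J)))"
proof -
  define S where "S = (SIGMA I:Pow K - {{}}. SIGMA J:Pow N. difunctional (K - I) (N - J))"
  define h where "h = (\<lambda>(I, J, R). I \<times> insert c J \<union> R :: ('a \<times> 'b) set)"
  have S: "I \<subseteq> K \<and> I \<noteq> {} \<and> J \<subseteq> N \<and> R \<subseteq> (K - I) \<times> (N - J)
      \<and> R \<in> difunctional (K - I) (N - J)" if "(I, J, R) \<in> S" for I J R
    using that unfolding S_def by (simp add: difunctional_subset)
  have column: "(h (I, J, R))\<inverse> `` {c} = I" and other: "h (I, J, R) `` I - {c} = J"
    and rest: "h (I, J, R) \<inter> (- I) \<times> UNIV = R" if "(I, J, R) \<in> S" for I J R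
  proof -
    have R: "R \<subseteq> (K - I) \<times> (N - J)" and "I \<noteq> {}" "c \<notin> J" using S[OF that] c by blast+
    show "(h (I, J, R))\<inverse> `` {c} = I" using R c by (auto simp: h_def)
    show "h (I, J, R) `` I - {c} = J" using R \<open>I \<noteq> {}\<close> \<open>c \<notin> J\<close> by (auto simp: h_def)
    show "h (I, J, R) \<inter> (- I) \<times> UNIV = R" using R by (auto simp: h_def)
  qed
  have "inj_on h S"
  proof (rule inj_onI, unfold split_paired_all)
    fix I J R I' J' R'
    assume "(I, J, R) \<in> S" "(I', J', R') \<in> S" "h (I, J, R) = h (I', J', R')"
    moreover from this have "I = I'" using column by metis
    ultimately show "(I, J, R) = (I', J', R')" using other rest by metis
  qed
  moreover have "difunctional K N \<inter> h ` S = {}"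
  proof -
    have "h x \<notin> difunctional K N" if "x \<in> S" for x
    proof (cases x)
      case (fields I J R)
      then have "I \<noteq> {}" "(h x)\<inverse> `` {c} = I" using S[of I J R] column[of I J R] that by auto
      then show ?thesis using c difunctional_subset[of "h x" K N] by blast
    qed
    then show ?thesis by blast
  qed
  moreover have "difunctional K (insert c N) = difunctional K N \<union> h ` S"
  proof (intro equalityI subsetI)
    fix R assume R: "R \<in> difunctional K (insert c N)"
    define I where "I = R\<inverse> `` {c}"
    define J where "J = R `` I"
    define R' where "R' = R \<inter> ((K - I) \<times> (insert c N - J))"
    show "R \<in> difunctional K N \<union> h ` S"
    proof (cases "I = {}")
      case True
      then have "R \<subseteq> K \<times> N" using difunctional_subset[OF R] unfolding I_def by blast
      then show ?thesis using R by (simp add: difunctional_def)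
    next
      case False
      then have "c \<in> J" unfolding I_def J_def by blast
      then have N: "insert c N - J = N - (J - {c})" and J: "insert c (J - {c}) = J"
        using c by blast+
      have "R = h (I, J - {c}, R')"
        using split_block_difunctional(1)[OF R, of c]
        by (simp add: h_def J insert_absorb[OF \<open>c \<in> J\<close>] flip: I_def J_def R'_def)
      moreover have R': "R' \<in> difunctional (K - I) (N - (J - {c}))"
        using split_block_difunctional(2)[OF R, of c]
        unfolding I_def[symmetric] J_def[symmetric] R'_def N .
      have "(I, J - {c}, R') \<in> S"
        using False R' difunctional_subset[OF R] unfolding S_def I_def J_def by blast
      ultimately show ?thesis by blast
    qed
  next
    fix R assume "R \<in> difunctional K N \<union> h ` S"
    then show "R \<in> difunctional K (insert c N)"
    proof
      assume "R \<in> h ` S"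
      then obtain I J R' where x: "(I, J, R') \<in> S" "R = h (I, J, R')" by (metis imageE prod_cases3)
      have "insert c N - insert c J = N - J" using c by blast
      then show ?thesis
        using S[OF x(1)] add_block_difunctional[of I K "insert c J" "insert c N" R']
        by (simp add: x(2) h_def subset_insertI2)
    next
      assume R: "R \<in> difunctional K N"
      then have "R \<subseteq> K \<times> insert c N" using difunctional_subset by blast
      then show ?thesis using R by (simp add: difunctional_def)
    qed
  qed
  moreover have "finite (difunctional K N)" "finite S"
    using fin by (auto simp: S_def intro!: finite_difunctional finite_SigmaI)
  ultimately have "card (difunctional K (insert c N)) = card (difunctional K N) + card S"
    by (simp add: card_Un_disjoint card_image)
  also have "card S = (\<Sum>I\<in>Pow K - {{}}. \<Sum>J\<in>Pow N. card (difunctional (K - I) (N - J)))"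
    unfolding S_def using fin
    by (subst card_SigmaI; auto intro!: sum.cong card_SigmaI finite_SigmaI finite_difunctional)
  finally show ?thesis .
qed

section \<open>Matrices as relations\<close>

lemma exchange_class_Gamma_iff:
  assumes "M \<in> carrier_mat 2 2"
  shows "M \<in> exchange_class Gamma_mat \<longleftrightarrow>
    (M $$ (0, 0), M $$ (0, 1), M $$ (1, 0), M $$ (1, 1))
      \<in> {(1, 1, 1, 0), (1, 1, 0, 1), (1, 0, 1, 1), (0, 1, 1, 1)}"
proof -
  have "M = mat_of_rows_list 2 [[p, q], [r, s]] \<longleftrightarrow>
      M $$ (0, 0) = p \<and> M $$ (0, 1) = q \<and> M $$ (1, 0) = r \<and> M $$ (1, 1) = s" for p q r s
    using assms by (auto simp: mat_of_rows_list_def less_Suc_eq less_2_cases_iff intro!: eq_matI)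
  then show ?thesis unfolding exchange_class_Gamma_mat by simp
qed

lemma submatrix_Gamma_iff:
  fixes A :: "nat mat"
  assumes "i1 < i2" "i2 < dim_row A" "j1 < j2" "j2 < dim_col A"
  shows "submatrix A {i1, i2} {j1, j2} \<in> exchange_class Gamma_mat \<longleftrightarrow>
    (A $$ (i1, j1), A $$ (i1, j2), A $$ (i2, j1), A $$ (i2, j2))
      \<in> {(1, 1, 1, 0), (1, 1, 0, 1), (1, 0, 1, 1), (0, 1, 1, 1)}"
proof -
  have dims: "{i. i < dim_row A \<and> i \<in> {i1, i2}} = {i1, i2}"
      "{j. j < dim_col A \<and> j \<in> {j1, j2}} = {j1, j2}"
    using assms by auto
  have "submatrix A {i1, i2} {j1, j2} \<in> carrier_mat 2 2"
    using assms unfolding carrier_mat_def mem_Collect_eq dim_submatrix dims by simp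
  moreover have pos: "card {a \<in> {x, y}. a < x} = 0" "card {a \<in> {x, y}. a < y} = 1"
    if "x < y" for x y :: nat
  proof -
    have "{a \<in> {x, y}. a < x} = {}" "{a \<in> {x, y}. a < y} = {x}" using that by auto
    then show "card {a \<in> {x, y}. a < x} = 0" "card {a \<in> {x, y}. a < y} = 1" by simp_all
  qed
  note idx = submatrix_index_card[of _ A _ "{i1, i2}" "{j1, j2}"]
  have "submatrix A {i1, i2} {j1, j2} $$ (0, 0) = A $$ (i1, j1)"
    using idx[of i1 j1] assms by (simp only: pos) simp
  moreover have "submatrix A {i1, i2} {j1, j2} $$ (0, 1) = A $$ (i1, j2)"
    using idx[of i1 j2] assms by (simp only: pos) simp
  moreover have "submatrix A {i1, i2} {j1, j2} $$ (1, 0) = A $$ (i2, j1)"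
    using idx[of i2 j1] assms by (simp only: pos) simp
  moreover have "submatrix A {i1, i2} {j1, j2} $$ (1, 1) = A $$ (i2, j2)"
    using idx[of i2 j2] assms by (simp only: pos) simp
  ultimately show ?thesis by (simp only: exchange_class_Gamma_iff)
qed

definition support :: "nat mat \<Rightarrow> (nat \<times> nat) set" where
  "support A = {(i, j). i < dim_row A \<and> j < dim_col A \<and> A $$ (i, j) = 1}"

text \<open>
  Avoidance speaks of increasing pairs of indices, difunctionality of arbitrary ones. The two
  agree because the class of \<open>\<Gamma>\<close> is closed under exchanges, so that the position of the zero
  among the four corners does not matter; rectangles with \<open>i = i'\<close> or \<open>j = j'\<close> are harmless.
\<close>

lemma avoids_Gamma_iff:
  assumes "A \<in> zero_one_mats k n"
  shows "avoids A Gamma_mat \<longleftrightarrow> support A \<in> difunctional {..<k} {..<n}"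
proof -
  have dim: "dim_row A = k" "dim_col A = n" using assms by (auto simp: zero_one_mats_def)
  have entry: "A $$ (i, j) = 0 \<or> A $$ (i, j) = 1" if "i < k" "j < n" for i j
    using assms that unfolding zero_one_mats_def by blast
  have sub: "support A \<subseteq> {..<k} \<times> {..<n}" using dim by (auto simp: support_def)
  show ?thesis
  proof
    assume av: "avoids A Gamma_mat"
    have no: "(A $$ (i1, j1), A $$ (i1, j2), A $$ (i2, j1), A $$ (i2, j2))
        \<notin> {(1, 1, 1, 0), (1, 1, 0, 1), (1, 0, 1, 1), (0, 1, 1, 1)}"
      if "i1 < i2" "i2 < k" "j1 < j2" "j2 < n" for i1 i2 j1 j2
      using av submatrix_Gamma_iff[of i1 i2 A j1 j2] that dim unfolding avoids_def by blast
    have "(i', j') \<in> support A"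
      if R: "(i, j) \<in> support A" "(i, j') \<in> support A" "(i', j) \<in> support A" for i j i' j'
    proof (rule ccontr)
      assume "(i', j') \<notin> support A"
      with R entry[of i' j'] have *: "i < k" "i' < k" "j < n" "j' < n" "A $$ (i', j') = 0"
        "A $$ (i, j) = 1" "A $$ (i, j') = 1" "A $$ (i', j) = 1"
        by (auto simp: support_def dim)
      then have "i \<noteq> i'" "j \<noteq> j'" by auto
      then consider "i < i'" "j < j'" | "i < i'" "j' < j" | "i' < i" "j < j'" | "i' < i" "j' < j"
        by linarith
      then show False
        using no[of i i' j j'] no[of i i' j' j] no[of i' i j j'] no[of i' i j' j] *
        by cases simp_all
    qed
    with sub show "support A \<in> difunctional {..<k} {..<n}" unfolding difunctional_iff by blast
  next
    assume R: "support A \<in> difunctional {..<k} {..<n}"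
    have closed: "A $$ (i', j') = 1" if "A $$ (i, j) = 1" "A $$ (i, j') = 1" "A $$ (i', j) = 1"
      "i < k" "i' < k" "j < n" "j' < n" for i j i' j'
    proof -
      have "(i, j) \<in> support A" "(i, j') \<in> support A" "(i', j) \<in> support A"
        using that dim by (auto simp: support_def)
      then have "(i', j') \<in> support A" using R unfolding difunctional_iff by blast
      then show ?thesis by (simp add: support_def)
    qed
    show "avoids A Gamma_mat"
      unfolding avoids_def
    proof (intro allI impI, elim conjE)
      fix i1 i2 j1 j2
      assume *: "i1 < i2" "i2 < dim_row A" "j1 < j2" "j2 < dim_col A"
      then have "i1 < k" "i2 < k" "j1 < n" "j2 < n" using dim by auto
      then show "submatrix A {i1, i2} {j1, j2} \<notin> exchange_class Gamma_mat"
        using closed[of i1 j1 j2 i2] closed[of i1 j2 j1 i2] closed[of i2 j1 j2 i1]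
          closed[of i2 j2 j1 i1] unfolding submatrix_Gamma_iff[OF *] by auto
    qed
  qed
qed

lemma phi_Gamma: "phi k n Gamma_mat = card (difunctional {..<k} {..<n})"
proof -
  define M where "M = (\<lambda>R. mat k n (\<lambda>ij. if ij \<in> R then 1 else 0 :: nat))"
  have M: "M R \<in> zero_one_mats k n" for R
    by (auto simp: M_def zero_one_mats_def elements_mat_def)
  have support_M: "support (M R) = R" if "R \<subseteq> {..<k} \<times> {..<n}" for R
    using that by (auto simp: support_def M_def split: if_splits)
  have M_support: "M (support A) = A" if "A \<in> zero_one_mats k n" for A
  proof (rule eq_matI)
    fix i j assume "i < dim_row A" "j < dim_col A"
    moreover have "A \<in> carrier_mat k n" "elements_mat A \<subseteq> {0, 1}"
      using that by (auto simp: zero_one_mats_def)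
    ultimately have "A $$ (i, j) \<in> {0, 1}" "i < k" "j < n" by blast+
    then show "M (support A) $$ (i, j) = A $$ (i, j)"
      using \<open>i < dim_row A\<close> \<open>j < dim_col A\<close> by (auto simp: M_def support_def)
  qed (use that in \<open>auto simp: M_def zero_one_mats_def\<close>)
  have "bij_betw support {A \<in> zero_one_mats k n. avoids A Gamma_mat}
      (difunctional {..<k} {..<n})"
  proof (rule bij_betw_byWitness[where f' = M])
    show "M ` difunctional {..<k} {..<n} \<subseteq> {A \<in> zero_one_mats k n. avoids A Gamma_mat}"
      by (auto simp: M avoids_Gamma_iff[OF M] support_M difunctional_subset)
  qed (auto simp: M_support support_M avoids_Gamma_iff difunctional_subset)
  then show ?thesis unfolding phi_def by (rule bij_betw_same_card)
qed

section \<open>The exponential series\<close>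

text \<open>
  The partial derivative is the one with respect to \<open>y\<close>. As \<open>biexp\<close> is a coefficientwise sum and
  not a limit, the argument is made with the partial sums \<open>T N\<close> of the exponential series: they
  satisfy \<open>T' (N + 1) = F' T N\<close> exactly, and agree with \<open>biexp F\<close> in total degree at most \<open>N\<close>.
\<close>

lemma fps_deriv_biexp:
  assumes F: "F $ 0 $ 0 = 0"
  shows "fps_deriv (biexp F) = fps_deriv F * biexp F"
proof (intro fps_ext)
  fix n k
  define T where "T N = (\<Sum>m\<le>N. fps_const (fps_const (1 / fact m)) * F ^ m)" for N
  have T: "T N $ i $ j = biexp F $ i $ j" if "i + j \<le> N" for N i j
  proof -
    have "T N $ i $ j = (\<Sum>m\<le>N. (F ^ m) $ i $ j / fact m)"
      by (simp add: T_def fps_sum_nth)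
    also have "\<dots> = (\<Sum>m\<le>i + j. (F ^ m) $ i $ j / fact m)"
      using that by (intro sum.mono_neutral_right) (auto simp: power_nth_nth_eq_0[OF F])
    finally show ?thesis by (simp add: biexp_nth_nth[OF F])
  qed
  have deriv_T: "fps_deriv (T (Suc N)) = fps_deriv F * T N" for N
  proof -
    have "fps_deriv (fps_const (fps_const (1 / fact (Suc m))) * F ^ Suc m)
        = fps_deriv F * (fps_const (fps_const (1 / fact m)) * F ^ m)" for m
    proof -
      have "fps_const (fps_const (1 / fact (Suc m))) * of_nat (Suc m)
          = (fps_const (fps_const (1 / fact m)) :: bifps)"
        by (simp add: fps_of_nat[symmetric] field_simps del: of_nat_Suc)
      then show ?thesis
        by (simp only: fps_deriv_mult_const_left fps_deriv_power' diff_Suc_1 mult.assoc[symmetric])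
          (simp add: mult_ac)
    qed
    then show ?thesis
      unfolding T_def by (subst sum.atMost_Suc_shift) (simp add: fps_deriv_sum sum_distrib_left del: power_Suc)
  qed
  have "fps_deriv (biexp F) $ n $ k = fps_deriv (T (Suc (n + k))) $ n $ k"
    using T[of "Suc n" k "Suc (n + k)"] by (simp add: fps_of_nat[symmetric] del: of_nat_Suc)
  also have "\<dots> = (fps_deriv F * biexp F) $ n $ k"
    unfolding deriv_T by (auto simp: fps_mult_nth fps_sum_nth T intro!: sum.cong)
  finally show "fps_deriv (biexp F) $ n $ k = (fps_deriv F * biexp F) $ n $ k" .
qed

definition block_series :: bifps where
  "block_series = (biexp X - 1) * (biexp Y - 1) + X + Y"

lemma block_series_nth_0: "block_series $ 0 = fps_X"
proof -
  have "X $ 0 = fps_X" "Y $ 0 = 0" by (simp_all add: X_def Y_def)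
  then show ?thesis by (simp add: block_series_def biexp_Y)
qed

lemma biexp_block_series_0: "biexp block_series $ 0 $ k = 1 / fact k"
proof -
  have "(block_series ^ m) $ 0 = fps_X ^ m" for m
    by (simp add: fps_nth_power_0 block_series_nth_0)
  then show ?thesis
    by (subst biexp_nth_nth)
      (auto simp: block_series_nth_0 fps_X_power_nth if_distrib[of "\<lambda>c. c / _"] cong: if_cong)
qed

lemma fps_deriv_block_series: "fps_deriv block_series = (biexp X - 1) * biexp Y + 1"
proof -
  have "fps_deriv (biexp Y) = biexp Y"
    using fps_deriv_biexp[of Y] by (simp add: Y_def)
  moreover have "fps_deriv X = 0" "fps_deriv Y = 1" by (simp_all add: X_def Y_def)
  ultimately show ?thesis by (simp add: block_series_def biexp_X)
qed

text \<open>
  The differential equation of \<open>biexp block_series\<close>, read off at \<open>x^k y^n\<close>. The condition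
  \<open>j \<noteq> 0\<close> comes from the factor \<open>e^x - 1\<close> and matches the nonempty row set of a block.
\<close>

lemma biexp_block_series_Suc:
  fixes c :: "nat \<Rightarrow> nat \<Rightarrow> real"
  defines "c \<equiv> \<lambda>k n. biexp block_series $ n $ k"
  shows "real (Suc n) * c k (Suc n) = c k n +
    (\<Sum>j\<le>k. \<Sum>i\<le>n. (if j = 0 then 0 else 1 / fact j) / fact i * c (k - j) (n - i))"
proof -
  have coeff: "((biexp X - 1) * biexp Y) $ i $ j = (if j = 0 then 0 else 1 / fact j) / fact i" for i j
  proof -
    have "biexp X - 1 = fps_const (fps_exp 1 - 1)"
      by (simp add: biexp_X flip: fps_const_1_eq_1)
    then show ?thesis by (simp add: biexp_Y)
  qed
  have "real (Suc n) * c k (Suc n) = fps_deriv (biexp block_series) $ n $ k"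
    by (simp add: c_def fps_of_nat[symmetric] del: of_nat_Suc)
  also have "\<dots> = (((biexp X - 1) * biexp Y + 1) * biexp block_series) $ n $ k"
    by (simp add: fps_deriv_biexp block_series_nth_0 fps_deriv_block_series)
  also have "\<dots> = c k n + (\<Sum>i\<le>n. \<Sum>j\<le>k. ((biexp X - 1) * biexp Y) $ i $ j * c (k - j) (n - i))"
    by (simp only: distrib_right mult_1 fps_add_nth fps_mult_nth[of "_ * _"] c_def
        fps_sum_nth atMost_atLeast0 add.commute[of _ "biexp block_series $ n $ k"])
      (simp add: fps_sum_nth fps_mult_nth)
  finally show ?thesis
    unfolding coeff by (subst sum.swap)
qed

section \<open>Counting\<close>

lemma sum_Pow_card:
  fixes f :: "nat \<Rightarrow> 'a::semiring_1"
  assumes "finite A"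
  shows "(\<Sum>S\<in>Pow A. f (card S)) = (\<Sum>i\<le>card A. of_nat (card A choose i) * f i)"
proof -
  have "(\<Sum>S\<in>Pow A. f (card S)) = (\<Sum>i\<le>card A. \<Sum>S\<in>{S \<in> Pow A. card S = i}. f (card S))"
    using assms by (intro sum.group[symmetric]) (auto intro: card_mono)
  also have "\<dots> = (\<Sum>i\<le>card A. of_nat (card {S. S \<subseteq> A \<and> card S = i}) * f i)"
    by (auto intro!: sum.cong)
  finally show ?thesis by (simp add: n_subsets[OF assms])
qed

text \<open>
  By induction on the number of columns, for all finite sets at once: the recursion removes
  arbitrary subsets, and this way no separate argument is needed that the count depends on the
  two cardinalities only.
\<close>

lemma card_difunctional:
  assumes "finite K" "finite N"
  shows "real (card (difunctional K N)) =
    fact (card K) * fact (card N) * biexp block_series $ card N $ card K"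
  using assms
proof (induction "card N" arbitrary: K N rule: less_induct)
  case less
  define c where "c = (\<lambda>k n. biexp block_series $ n $ k)"
  show ?case
  proof (cases "N = {}")
    case True
    then show ?thesis by (simp add: difunctional_empty biexp_block_series_0)
  next
    case False
    then obtain a N' where N: "N = insert a N'" "a \<notin> N'" by (metis mk_disjoint_insert equals0I)
    define k n where "k = card K" and "n = card N'"
    have fin: "finite K" "finite N'" using less.prems N by auto
    have card_N: "card N = Suc n" using N fin by (simp add: n_def)
    \<comment> \<open>\<open>g j i\<close> counts the relations left over by a block with \<open>j\<close> rows and, besides \<open>a\<close>, \<open>i\<close> columns\<close>
    define g where "g = (\<lambda>j i. if j = 0 then 0 else fact (k - j) * fact (n - i) * c (k - j) (n - i))"
    have IH: "real (card (difunctional (K - I) (N' - J)))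
        = fact (k - card I) * fact (n - card J) * c (k - card I) (n - card J)"
      if "I \<subseteq> K" "J \<subseteq> N'" for I J
    proof -
      have "card (K - I) = k - card I" "card (N' - J) = n - card J"
        using that fin by (auto simp: k_def n_def card_Diff_subset finite_subset)
      then show ?thesis using less.hyps[of "N' - J" "K - I"] fin by (simp add: card_N c_def)
    qed
    have "real (card (difunctional K N)) = real (card (difunctional K N')) +
        (\<Sum>I\<in>Pow K - {{}}. \<Sum>J\<in>Pow N'. real (card (difunctional (K - I) (N' - J))))"
      by (simp add: N card_difunctional_insert[OF fin N(2)])
    also have "(\<Sum>I\<in>Pow K - {{}}. \<Sum>J\<in>Pow N'. real (card (difunctional (K - I) (N' - J))))
        = (\<Sum>I\<in>Pow K. \<Sum>J\<in>Pow N'. g (card I) (card J))"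
      using fin by (intro sum.mono_neutral_cong_left)
        (auto simp: g_def IH card_eq_0_iff dest: finite_subset intro!: sum.cong)
    also have "\<dots> = (\<Sum>j\<le>k. \<Sum>i\<le>n. real (k choose j) * real (n choose i) * g j i)"
      using sum_Pow_card[OF fin(1), of "\<lambda>j. \<Sum>J\<in>Pow N'. g j (card J)"]
      by (simp add: sum_Pow_card[OF fin(2)] sum_distrib_left mult.assoc flip: k_def n_def)
    also have "\<dots> = (\<Sum>j\<le>k. \<Sum>i\<le>n. fact k * fact n *
        ((if j = 0 then 0 else 1 / fact j) / fact i * c (k - j) (n - i)))"
      by (intro sum.cong refl) (simp add: g_def binomial_fact)
    also have "real (card (difunctional K N')) = fact k * fact n * c k n"
      using IH[of "{}" "{}"] by simp
    also have "fact k * fact n * c k n + (\<Sum>j\<le>k. \<Sum>i\<le>n. fact k * fact n *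
        ((if j = 0 then 0 else 1 / fact j) / fact i * c (k - j) (n - i)))
        = fact k * fact n * (real (Suc n) * c k (Suc n))"
      unfolding c_def biexp_block_series_Suc by (simp add: distrib_left sum_distrib_left)
    finally show ?thesis by (simp add: card_N k_def c_def mult_ac)
  qed
qed

lemma biegf_phi: "biegf (\<lambda>k n. phi k n Gamma_mat) = biexp block_series"
  by (intro fps_ext) (simp add: biegf_def phi_Gamma card_difunctional)

lemma phi_axes: "phi k 0 Gamma_mat = 1" "phi 0 n Gamma_mat = 1"
  by (simp_all add: phi_Gamma difunctional_empty)

text \<open>
  \<open>e^x - 1\<close> and \<open>e^y - 1\<close> are the generating functions of the matrices with rows but no columns
  and with columns but no rows.
\<close>

lemma biegf_phi_pos:
  "biegf (\<lambda>k n. phi_pos k n Gamma_mat)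
    = biegf (\<lambda>k n. phi k n Gamma_mat) - (biexp X - 1) - (biexp Y - 1)"
proof (intro fps_ext)
  fix n k
  have "phi_pos k n Gamma_mat =
      (if k = 0 \<and> n = 0 then 1 else if k = 0 \<or> n = 0 then 0 else phi k n Gamma_mat)"
    by (simp add: phi_pos_def phi_def)
  then show "biegf (\<lambda>k n. phi_pos k n Gamma_mat) $ n $ k
      = (biegf (\<lambda>k n. phi k n Gamma_mat) - (biexp X - 1) - (biexp Y - 1)) $ n $ k"
    by (simp add: biegf_def biexp_X biexp_Y phi_axes fps_numeral_nth)
qed

theorem mainTheorem2:
  shows "biegf (\<lambda>k n. phi k n Gamma_mat)
           = biexp ((biexp X - 1) * (biexp Y - 1) + X + Y)
       \<and> biegf (\<lambda>k n. phi_pos k n Gamma_mat)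
           = biexp ((biexp X - 1) * (biexp Y - 1) + X + Y) - (biexp X - 1) - (biexp Y - 1)"
  using biegf_phi biegf_phi_pos by (simp add: block_series_def)

end
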